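(* Let $l\ge 2$ and let $d_1,\dots,d_l\ge 2$ be natural numbers. The space of tensorial bodies $\mathcal{B}_\otimes(d_1,\dots,d_l)$ is not closed with respect to the Minkowski sum, i.e. there exist $P,R\in\mathcal{B}_\otimes(d_1,\dots,d_l)$ such that $P+R=\{x+y:x\in P,y\in R\}\notin\mathcal{B}_\otimes(d_1,\dots,d_l)$.
   Context: For $d\in\mathbb{N}$, $\mathbb{R}^d$ carries its standard inner product. The tensor product $\otimes_{i=1}^l\mathbb{R}^{d_i}$ carries the inner product $\langle\cdot,\cdot\rangle_H$ determined by $\langle x^1\otimes\cdots\otimes x^l,y^1\otimes\cdots\otimes y^l\rangle_H=\prod_{i=1}^l\langle x^i,y^i\rangle$. A 0-symmetric convex body is a compact convex set $P$ with nonempty interior and $P=-P$; $\mathcal{B}(d)$ is the set of these in $\mathbb{R}^d$. The polar is $P^\circ=\{y:\langle x,y\rangle\le 1\ \forall x\in P\}$ (using $\langle\cdot,\cdot\rangle_H$ in the tensor product). For $P_i\in\mathcal{B}(d_i)$, $i=1,\dots,l$, let $P_1\otimes_\pi\cdots\otimes_\pi P_l:=\mathrm{conv}\{x^1\otimes\cdots\otimes x^l: x^i\in P_i\}$ and $P_1\otimes_\epsilon\cdots\otimes_\epsilon P_l:=(P_1^\circ\otimes_\pi\cdots\otimes_\pi P_l^\circ)^\circ$. A 0-symmetric convex body $P\subset\otimes_{i=1}^l\mathbb{R}^{d_i}$ is a tensorial body if there are $P_i\in\mathcal{B}(d_i)$ with $P_1\otimes_\pi\cdots\otimes_\pi P_l\subseteq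 P\subseteq P_1\otimes_\epsilon\cdots\otimes_\epsilon P_l$. $\mathcal{B}_\otimes(d_1,\dots,d_l)$ is the set of all tensorial bodies in $\otimes_{i=1}^l\mathbb{R}^{d_i}$. *)

theory Defs
  imports "HOL-Analysis.Analysis" "HOL-Analysis.Finite_Function_Topology"
begin

text \<open>
  Since the number of factors and their dimensions are arbitrary natural numbers, all spaces are
  finite-dimensional coordinate subspaces of the real normed spaces \<open>'i \<Rightarrow>\<^sub>0 real\<close> of
  finitely supported functions. On a coordinate subspace with finitely many coordinates
  the (\<open>l\<^sup>1\<close>-)norm topology of \<open>'i \<Rightarrow>\<^sub>0 real\<close> is the usual Euclidean topology.
\<close>

definition coord_space :: "'i set \<Rightarrow> ('i \<Rightarrow>\<^sub>0 real) set"
  where "coord_space I = {x. Poly_Mapping.keys x \<subseteq> I}"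

definition dot :: "('i \<Rightarrow>\<^sub>0 real) \<Rightarrow> ('i \<Rightarrow>\<^sub>0 real) \<Rightarrow> real"
  where "dot x y = (\<Sum>i\<in>Poly_Mapping.keys x. Poly_Mapping.lookup x i * Poly_Mapping.lookup y i)"

text \<open>Euclidean space of dimension \<open>n\<close>, with coordinates \<open>0, \<dots>, n - 1\<close>.\<close>

definition eucl :: "nat \<Rightarrow> (nat \<Rightarrow>\<^sub>0 real) set"
  where "eucl n = coord_space {..<n}"

text \<open>
  The tensor product of the spaces \<open>eucl (d i)\<close> for \<open>i < l\<close> is realised by its coordinates with
  respect to the basis of tensor products of standard basis vectors (see \<open>elem_tensor_basis\<close>),
  which is indexed by multi-indices. The inner product of the tensor product is
  \<open>dot\<close>, by lemma \<open>dot_elem_tensor\<close>.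
\<close>

definition multi_indices :: "nat \<Rightarrow> (nat \<Rightarrow> nat) \<Rightarrow> (nat \<Rightarrow> nat) set"
  where "multi_indices l d = (\<Pi>\<^sub>E i\<in>{..<l}. {..<d i})"

definition tensor_space :: "nat \<Rightarrow> (nat \<Rightarrow> nat) \<Rightarrow> ((nat \<Rightarrow> nat) \<Rightarrow>\<^sub>0 real) set"
  where "tensor_space l d = coord_space (multi_indices l d)"

definition elem_tensor ::
    "nat \<Rightarrow> (nat \<Rightarrow> nat) \<Rightarrow> (nat \<Rightarrow> nat \<Rightarrow>\<^sub>0 real) \<Rightarrow> ((nat \<Rightarrow> nat) \<Rightarrow>\<^sub>0 real)"
  where "elem_tensor l d x = Abs_poly_mapping
    (\<lambda>j. if j \<in> multi_indices l d then \<Prod>i<l. Poly_Mapping.lookup (x i) (j i) else 0)"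

lemma finite_multi_indices: "finite (multi_indices l d)"
  unfolding multi_indices_def by (intro finite_PiE) auto

lemma lookup_elem_tensor:
  "Poly_Mapping.lookup (elem_tensor l d x) j =
    (if j \<in> multi_indices l d then \<Prod>i<l. Poly_Mapping.lookup (x i) (j i) else 0)"
  unfolding elem_tensor_def
  by (subst Abs_poly_mapping_inverse)
     (auto intro: finite_subset[OF _ finite_multi_indices[of l d]])

lemma dot_eq_sum:
  assumes "finite I" "x \<in> coord_space I"
  shows "dot x y = (\<Sum>i\<in>I. Poly_Mapping.lookup x i * Poly_Mapping.lookup y i)"
  unfolding dot_def using assms
  by (intro sum.mono_neutral_left) (auto simp: coord_space_def in_keys_iff)

lemma elem_tensor_in_tensor_space: "elem_tensor l d x \<in> tensor_space l d"
  by (auto simp: tensor_space_def coord_space_def in_keys_iff lookup_elem_tensor split: if_splits)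

lemma dot_elem_tensor:
  assumes "\<And>i. i < l \<Longrightarrow> x i \<in> eucl (d i)"
  shows "dot (elem_tensor l d x) (elem_tensor l d y) = (\<Prod>i<l. dot (x i) (y i))"
proof -
  have "dot (elem_tensor l d x) (elem_tensor l d y) =
      (\<Sum>j\<in>multi_indices l d. \<Prod>i<l. Poly_Mapping.lookup (x i) (j i) * Poly_Mapping.lookup (y i) (j i))"
    using elem_tensor_in_tensor_space[of l d x]
    by (simp add: dot_eq_sum[OF finite_multi_indices] tensor_space_def lookup_elem_tensor
        prod.distrib)
  also have "\<dots> = (\<Prod>i<l. \<Sum>k<d i. Poly_Mapping.lookup (x i) k * Poly_Mapping.lookup (y i) k)"
    unfolding multi_indices_def by (subst prod_sum_PiE) auto
  also have "\<dots> = (\<Prod>i<l. dot (x i) (y i))"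
    using assms by (intro prod.cong refl dot_eq_sum[symmetric]) (auto simp: eucl_def)
  finally show ?thesis .
qed

lemma elem_tensor_basis:
  assumes "j \<in> multi_indices l d"
  shows "elem_tensor l d (\<lambda>i. Poly_Mapping.single (j i) 1) = Poly_Mapping.single j 1"
proof (rule poly_mapping_eqI)
  fix k
  have "j = k" if "k \<in> multi_indices l d" "\<forall>i<l. j i = k i"
    using that assms unfolding multi_indices_def by (intro PiE_ext) auto
  then show "Poly_Mapping.lookup (elem_tensor l d (\<lambda>i. Poly_Mapping.single (j i) 1)) k =
      Poly_Mapping.lookup (Poly_Mapping.single j 1) k"
    using assms by (auto simp: lookup_elem_tensor lookup_single when_def)
qed

text \<open>
  0-symmetric convex bodies of a space \<open>V\<close>; the interior is taken relative to \<open>V\<close>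
  (not relative to the ambient type, in which \<open>V\<close> has empty interior).
\<close>

definition sym_convex_bodies :: "('i \<Rightarrow>\<^sub>0 real) set \<Rightarrow> ('i \<Rightarrow>\<^sub>0 real) set set"
  where "sym_convex_bodies V =
    {P. P \<subseteq> V \<and> compact P \<and> convex P \<and> top_of_set V interior_of P \<noteq> {} \<and> P = uminus ` P}"

definition polar :: "('i \<Rightarrow>\<^sub>0 real) set \<Rightarrow> ('i \<Rightarrow>\<^sub>0 real) set \<Rightarrow> ('i \<Rightarrow>\<^sub>0 real) set"
  where "polar V P = {y \<in> V. \<forall>x\<in>P. dot x y \<le> 1}"

definition proj_tensor ::
    "nat \<Rightarrow> (nat \<Rightarrow> nat) \<Rightarrow> (nat \<Rightarrow> (nat \<Rightarrow>\<^sub>0 real) set) \<Rightarrow> ((nat \<Rightarrow> nat) \<Rightarrow>\<^sub>0 real) set"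
  where "proj_tensor l d P = convex hull {elem_tensor l d x | x. \<forall>i<l. x i \<in> P i}"

definition inj_tensor ::
    "nat \<Rightarrow> (nat \<Rightarrow> nat) \<Rightarrow> (nat \<Rightarrow> (nat \<Rightarrow>\<^sub>0 real) set) \<Rightarrow> ((nat \<Rightarrow> nat) \<Rightarrow>\<^sub>0 real) set"
  where "inj_tensor l d P =
    polar (tensor_space l d) (proj_tensor l d (\<lambda>i. polar (eucl (d i)) (P i)))"

definition tensorial_bodies :: "nat \<Rightarrow> (nat \<Rightarrow> nat) \<Rightarrow> ((nat \<Rightarrow> nat) \<Rightarrow>\<^sub>0 real) set set"
  where "tensorial_bodies l d =
    {P \<in> sym_convex_bodies (tensor_space l d).
      \<exists>Q. (\<forall>i<l. Q i \<in> sym_convex_bodies (eucl (d i))) \<and>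
          proj_tensor l d Q \<subseteq> P \<and> P \<subseteq> inj_tensor l d Q}"

end

theory Submission
  imports Defs
begin

text \<open>
  A tensorial body \<open>K\<close> has a support function that is multiplicative on elementary tensors:
  \<open>h\<^sub>K(y\<^sup>1 \<otimes> \<dots> \<otimes> y\<^sup>l) = \<Prod> h\<^sub>i(y\<^sup>i)\<close>, where \<open>h\<^sub>i\<close> is the support function of the \<open>i\<close>-th factor
  of the sandwich. The unit balls of the \<open>l\<^sup>1\<close>- and of the \<open>l\<^sup>\<infinity>\<close>-norm of the tensor space are both
  tensorial bodies, and the support function of their Minkowski sum is
  \<open>\<parallel>y\<parallel>\<^sub>\<infinity> + \<parallel>y\<parallel>\<^sub>1\<close>. Choosing each of \<open>y\<^sup>1, y\<^sup>2\<close> among \<open>e\<^sub>0\<close> and \<open>e\<^sub>0 + e\<^sub>1\<close> (and \<open>e\<^sub>0\<close> in the other slots)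
  gives the values \<open>2, 3, 3, 5\<close>, which would have to satisfy \<open>2 * 5 = 3 * 3\<close>.
\<close>

abbreviation "lookup \<equiv> Poly_Mapping.lookup"
abbreviation "keys \<equiv> Poly_Mapping.keys"
abbreviation "single \<equiv> Poly_Mapping.single"

text \<open>Otherwise the basis vector \<open>single 0 1\<close> is rewritten to the unit \<open>1\<close> of the convolution product.\<close>
declare single_one [simp del]

section \<open>The inner product of finitely supported functions\<close>

lemma lookup_scaleR [simp]:
  "lookup (c *\<^sub>R x) i = c *\<^sub>R lookup x i"
proof -
  have "finite {i. c *\<^sub>R lookup x i \<noteq> 0}"
    by (rule finite_subset[OF _ finite_keys[of x]]) (auto simp: in_keys_iff)
  then show ?thesis
    by (simp add: scaleR_poly_mapping_def)
qed

lemma dot_commute: "dot x y = dot y x"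
proof -
  have "dot x y = (\<Sum>i\<in>keys x \<union> keys y. lookup x i * lookup y i)"
    by (rule dot_eq_sum) (auto simp: coord_space_def)
  also have "\<dots> = (\<Sum>i\<in>keys x \<union> keys y. lookup y i * lookup x i)"
    by (simp add: mult.commute)
  also have "\<dots> = dot y x"
    by (rule dot_eq_sum[symmetric]) (auto simp: coord_space_def)
  finally show ?thesis .
qed

lemma dot_add_right: "dot x (y + z) = dot x y + dot x z"
  by (simp add: dot_def lookup_add distrib_left sum.distrib)

lemma dot_scaleR_right: "dot x (c *\<^sub>R y) = c * dot x y"
  by (simp add: dot_def sum_distrib_left algebra_simps)

lemma dot_add_left: "dot (x + y) z = dot x z + dot y z"
  by (metis dot_commute dot_add_right)

lemma dot_scaleR_left: "dot (c *\<^sub>R x) y = c * dot x y"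
  by (metis dot_commute dot_scaleR_right)

lemma dot_minus_left: "dot (- x) y = - dot x y"
  using dot_scaleR_left[of "-1" x y] by simp

lemma dot_single_left: "dot (single i c) y = c * lookup y i"
  by (auto simp: dot_def)

lemma dot_self_pos: "x \<noteq> 0 \<Longrightarrow> dot x x > 0"
  unfolding dot_def by (intro sum_pos) (auto simp: in_keys_iff zero_less_mult_iff)

section \<open>The norm of the ambient type as the sum norm, and its pairing with the maximum
  norm\<close>

lemma norm_eq_sum_keys: "norm x = (\<Sum>i\<in>keys x. norm (lookup x i))"
  by (simp add: norm_poly_mapping_def dist_poly_mapping_def)

lemma norm_eq_sum:
  assumes "finite I" "x \<in> coord_space I"
  shows "norm x = (\<Sum>i\<in>I. norm (lookup x i))"
  unfolding norm_eq_sum_keys using assms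
  by (intro sum.mono_neutral_left) (auto simp: coord_space_def in_keys_iff)

lemma norm_single: "norm (single i c) = norm c"
  by (simp add: norm_eq_sum_keys)

lemma norm_lookup_le: "norm (lookup x i) \<le> norm x"
proof (cases "i \<in> keys x")
  case True
  then show ?thesis
    unfolding norm_eq_sum_keys by (intro member_le_sum) auto
qed (simp add: in_keys_iff)

text \<open>Hoelder's inequality for the dual pair of the sum norm and the maximum norm.\<close>

lemma dot_le_norm:
  assumes "\<And>i. \<bar>lookup y i\<bar> \<le> c"
  shows "\<bar>dot x y\<bar> \<le> c * norm x"
proof -
  have "\<bar>dot x y\<bar> \<le> (\<Sum>i\<in>keys x. \<bar>lookup x i * lookup y i\<bar>)"
    unfolding dot_def by (rule sum_abs)
  also have "\<dots> \<le> (\<Sum>i\<in>keys x. \<bar>lookup x i\<bar> * c)"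
    by (intro sum_mono) (auto simp: abs_mult intro: mult_left_mono assms)
  also have "\<dots> = c * norm x"
    by (simp add: norm_eq_sum_keys sum_distrib_left mult.commute[of _ c])
  finally show ?thesis .
qed

text \<open>Supplies the continuity with which a linear functional attains its maximum on a compact
  body.\<close>

lemma bounded_linear_dot_left: "bounded_linear (\<lambda>x. dot x y)"
  by (rule bounded_linear_intro[where K = "norm y"])
     (use dot_le_norm[of y "norm y"] norm_lookup_le[of y] in
       \<open>auto simp: dot_add_left dot_scaleR_left mult.commute\<close>)

lemma coord_space_add: "x \<in> coord_space I \<Longrightarrow> y \<in> coord_space I \<Longrightarrow> x + y \<in> coord_space I"
  using Poly_Mapping.keys_add[of x y] by (auto simp: coord_space_def)

lemma coord_space_scaleR: "x \<in> coord_space I \<Longrightarrow> c *\<^sub>R x \<in> coord_space I"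
  by (auto simp: coord_space_def in_keys_iff)

lemma coord_space_uminus: "x \<in> coord_space I \<Longrightarrow> - x \<in> coord_space I"
  by (auto simp: coord_space_def in_keys_iff)

section \<open>The unit balls of the sum norm and of the maximum norm\<close>

definition sum_ball :: "'i set \<Rightarrow> ('i \<Rightarrow>\<^sub>0 real) set"
  where "sum_ball I = coord_space I \<inter> cball 0 1"

text \<open>The cube in the coordinates \<open>I\<close>. The bound can range over every index
  because coordinates outside \<open>I\<close> vanish.\<close>

definition max_ball :: "'i set \<Rightarrow> ('i \<Rightarrow>\<^sub>0 real) set"
  where "max_ball I = {x \<in> coord_space I. \<forall>i. \<bar>lookup x i\<bar> \<le> 1}"

lemma sum_ball_subset_max_ball: "sum_ball I \<subseteq> max_ball I"
proof
  fix x assume "x \<in> sum_ball I"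
  then show "x \<in> max_ball I"
    using order_trans[OF norm_lookup_le[of x]] by (auto simp: sum_ball_def max_ball_def)
qed

lemma convex_sum_ball: "convex (sum_ball I)"
  unfolding sum_ball_def
  by (intro convex_Int convex_cball) (auto simp: convex_def coord_space_add coord_space_scaleR)

lemma convex_max_ball: "convex (max_ball I)"
proof (rule convexI)
  fix x y :: "'a \<Rightarrow>\<^sub>0 real" and u v :: real
  assume *: "x \<in> max_ball I" "y \<in> max_ball I" "0 \<le> u" "0 \<le> v" "u + v = 1"
  have "\<bar>u * lookup x i + v * lookup y i\<bar> \<le> 1" for i
  proof -
    have "\<bar>u * lookup x i + v * lookup y i\<bar> \<le> u * \<bar>lookup x i\<bar> + v * \<bar>lookup y i\<bar>"
      using * abs_triangle_ineq[of "u * lookup x i" "v * lookup y i"] by (simp add: abs_mult)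
    also have "\<dots> \<le> u * 1 + v * 1"
      using * by (intro add_mono mult_left_mono) (auto simp: max_ball_def)
    finally show ?thesis using * by simp
  qed
  then show "u *\<^sub>R x + v *\<^sub>R y \<in> max_ball I"
    using * by (auto simp: max_ball_def coord_space_add coord_space_scaleR lookup_add)
qed

lemma bounded_linear_single: "bounded_linear (\<lambda>c :: real. single i c)"
proof (rule bounded_linear_intro[where K = 1])
  show "single i (r *\<^sub>R c) = r *\<^sub>R single i c" for r c :: real
    by (rule poly_mapping_eqI) (simp add: lookup_single when_def)
qed (simp_all add: norm_single single_add)

text \<open>Adding a coordinate turns the cube into a continuous image of an interval times the
  smaller cube. This drives the induction for compactness: in the ambient space, which may have
  infinite dimension, closed and bounded does not imply compact.\<close>

lemma max_ball_insert:
  assumes "i \<notin> I"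
  shows "max_ball (insert i I) = (\<lambda>(c, x). single i c + x) ` ({-1..1} \<times> max_ball I)"
proof (intro equalityI subsetI)
  fix x assume x: "x \<in> max_ball (insert i I)"
  have "lookup (x - single i (lookup x i)) k = (if k = i then 0 else lookup x k)" for k
    by (simp add: lookup_minus lookup_single when_def)
  then have "x - single i (lookup x i) \<in> max_ball I"
    using x by (auto simp: max_ball_def coord_space_def in_keys_iff split: if_splits)
  moreover have "lookup x i \<in> {-1..1}"
    using x by (auto simp: max_ball_def abs_le_iff minus_le_iff)
  ultimately show "x \<in> (\<lambda>(c, x). single i c + x) ` ({-1..1} \<times> max_ball I)"
    by (intro image_eqI[where x = "(lookup x i, x - single i (lookup x i))"]) auto
next
  fix x assume "x \<in> (\<lambda>(c, x). single i c + x) ` ({-1..1} \<times> max_ball I)"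
  then obtain c y where x: "x = single i c + y" and c: "\<bar>c\<bar> \<le> 1" and y: "y \<in> max_ball I"
    by auto
  \<comment> \<open>Since \<open>i\<close> lies outside \<open>I\<close>, the coordinate of the sum
    at \<open>i\<close> is exactly \<open>c\<close> and cannot exceed 1 in absolute value.\<close>
  have "lookup y i = 0"
    using y assms by (auto simp: max_ball_def coord_space_def in_keys_iff)
  then have "lookup x k = (if k = i then c else lookup y k)" for k
    by (simp add: x lookup_add lookup_single when_def)
  then show "x \<in> max_ball (insert i I)"
    using y c by (auto simp: max_ball_def coord_space_def in_keys_iff split: if_splits)
qed

lemma compact_max_ball: "finite I \<Longrightarrow> compact (max_ball I)"
proof (induction I rule: finite_induct)
  case empty
  have "max_ball {} = {0 :: 'a \<Rightarrow>\<^sub>0 real}"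
    by (auto simp: max_ball_def coord_space_def)
  then show ?case by simp
next
  case (insert i I)
  have "continuous_on UNIV (\<lambda>(c :: real, x). single i c + x)"
    unfolding case_prod_beta
    by (intro continuous_intros bounded_linear.continuous_on[OF bounded_linear_single])
  then show ?case
    unfolding max_ball_insert[OF insert.hyps(2)] using insert.IH
    by (intro compact_continuous_image compact_Times) (auto intro: continuous_on_subset)
qed

text \<open>The cross-polytope is a closed subset of the compact cube.\<close>

lemma compact_sum_ball:
  assumes "finite I" shows "compact (sum_ball I)"
proof -
  have "sum_ball I = max_ball I \<inter> cball 0 1"
    using sum_ball_subset_max_ball[of I] by (auto simp: sum_ball_def max_ball_def)
  then show ?thesis
    using compact_max_ball[OF assms] by (simp add: compact_Int_closed)
qed

section \<open>Symmetric convex bodies, and the polarity between cross-polytope and cube\<close>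

text \<open>Containing \<open>sum_ball I\<close> provides the relative interior: the open unit ball
  of the subspace then lies in \<open>P\<close>, with 0 in it.\<close>

lemma sym_convex_bodiesI:
  assumes "sum_ball I \<subseteq> P" "P \<subseteq> coord_space I" "compact P" "convex P" "\<And>x. x \<in> P \<Longrightarrow> - x \<in> P"
  shows "P \<in> sym_convex_bodies (coord_space I)"
proof -
  have "openin (top_of_set (coord_space I)) (coord_space I \<inter> ball 0 1)"
    by (intro openin_open_Int) auto
  moreover have "coord_space I \<inter> ball 0 1 \<subseteq> P"
    using assms(1) by (auto simp: sum_ball_def subset_iff)
  moreover have "0 \<in> coord_space I \<inter> ball 0 1"
    by (auto simp: coord_space_def)
  ultimately have "0 \<in> top_of_set (coord_space I) interior_of P"
    by (meson interior_of_maximal subsetD)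
  then have "top_of_set (coord_space I) interior_of P \<noteq> {}"
    by blast
  moreover have "P = uminus ` P"
  proof (intro equalityI subsetI)
    show "x \<in> uminus ` P" if "x \<in> P" for x
      using assms(5)[OF that] by (intro image_eqI[where x = "- x"]) auto
    show "x \<in> P" if "x \<in> uminus ` P" for x
      using that assms(5) by (elim imageE) simp
  qed
  ultimately show ?thesis
    unfolding sym_convex_bodies_def mem_Collect_eq using assms(2-4) by (intro conjI)
qed

lemma sym_convex_bodiesD:
  assumes "P \<in> sym_convex_bodies V"
  shows "P \<subseteq> V" "compact P" "top_of_set V interior_of P \<noteq> {}" "x \<in> P \<Longrightarrow> - x \<in> P"
proof -
  have *: "P \<subseteq> V \<and> compact P \<and> convex P \<and> top_of_set V interior_of P \<noteq> {} \<and> P = uminus ` P"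
    using assms unfolding sym_convex_bodies_def by (rule CollectD)
  from * show "P \<subseteq> V" by (elim conjE)
  from * show "compact P" by (elim conjE)
  from * show "top_of_set V interior_of P \<noteq> {}" by (elim conjE)
  show "- x \<in> P" if "x \<in> P"
    using * imageI[OF that, of uminus] by (elim conjE) (rule ssubst)
qed

lemma sum_ball_in_bodies: "finite I \<Longrightarrow> sum_ball I \<in> sym_convex_bodies (coord_space I)"
  by (rule sym_convex_bodiesI)
     (simp_all add: compact_sum_ball convex_sum_ball, auto simp: sum_ball_def coord_space_uminus)

lemma max_ball_in_bodies: "finite I \<Longrightarrow> max_ball I \<in> sym_convex_bodies (coord_space I)"
  by (rule sym_convex_bodiesI)
     (simp_all add: compact_max_ball convex_max_ball sum_ball_subset_max_ball,
      auto simp: max_ball_def coord_space_uminus)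

lemma dot_sum_ball_max_ball:
  assumes "x \<in> sum_ball I" "y \<in> max_ball J"
  shows "dot x y \<le> 1"
  using dot_le_norm[of y 1 x] assms by (auto simp: sum_ball_def max_ball_def)

text \<open>Testing against the two signed basis vectors in direction \<open>i\<close> bounds the
  coordinate at \<open>i\<close>.\<close>

lemma polar_sum_ball: "polar (coord_space I) (sum_ball I) \<subseteq> max_ball I"
proof
  fix y assume y: "y \<in> polar (coord_space I) (sum_ball I)"
  have "\<bar>lookup y i\<bar> \<le> 1" for i
  proof (cases "i \<in> I")
    case True
    then have "single i c \<in> sum_ball I" if "\<bar>c\<bar> = 1" for c
      using that by (auto simp: sum_ball_def norm_single coord_space_def)
    then have "c * lookup y i \<le> 1" if "\<bar>c\<bar> = 1" for c
      using that y by (auto simp: polar_def dot_single_left[symmetric])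
    from this[of 1] this[of "-1"] show ?thesis by auto
  next
    case False
    then have "i \<notin> keys y"
      using y by (auto simp: polar_def coord_space_def)
    then show ?thesis
      by (simp add: in_keys_iff)
  qed
  then show "y \<in> max_ball I"
    using y by (auto simp: polar_def max_ball_def)
qed

text \<open>Testing against the sign vector of \<open>y\<close>, a point of the cube, yields the sum
  norm of \<open>y\<close>.\<close>

lemma polar_max_ball: "polar (coord_space I) (max_ball I) \<subseteq> sum_ball I"
proof
  fix y assume y: "y \<in> polar (coord_space I) (max_ball I)"
  let ?x = "Poly_Mapping.map sgn y"
  have lookup_x: "lookup ?x i = sgn (lookup y i)" for i
    by (simp add: Poly_Mapping.map.rep_eq when_def)
  then have "keys ?x = keys y"
    by (auto simp: in_keys_iff sgn_eq_0_iff)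
  then have "?x \<in> max_ball I"
    using y by (auto simp: polar_def max_ball_def coord_space_def lookup_x abs_sgn_eq)
  then have "dot ?x y \<le> 1"
    using y by (auto simp: polar_def)
  moreover have "dot ?x y = norm y"
    by (subst dot_commute) (simp add: dot_def lookup_x norm_eq_sum_keys abs_sgn)
  ultimately show "y \<in> sum_ball I"
    using y by (auto simp: polar_def sum_ball_def)
qed

section \<open>Both unit balls are tensorial bodies\<close>

text \<open>The sum norm is a cross norm: a product of coordinate sums expands into one sum over all
  multi-indices.\<close>

lemma norm_elem_tensor:
  assumes "\<And>i. i < l \<Longrightarrow> x i \<in> eucl (d i)"
  shows "norm (elem_tensor l d x) = (\<Prod>i<l. norm (x i))"
proof -
  have "norm (elem_tensor l d x) = (\<Sum>j\<in>multi_indices l d. \<Prod>i<l. norm (lookup (x i) (j i)))"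
    using elem_tensor_in_tensor_space[of l d x]
    by (simp add: norm_eq_sum[OF finite_multi_indices] tensor_space_def lookup_elem_tensor abs_prod)
  also have "\<dots> = (\<Prod>i<l. \<Sum>k<d i. norm (lookup (x i) k))"
    unfolding multi_indices_def by (subst prod_sum_PiE) auto
  also have "\<dots> = (\<Prod>i<l. norm (x i))"
    using assms by (intro prod.cong refl norm_eq_sum[symmetric]) (auto simp: eucl_def)
  finally show ?thesis .
qed

lemma elem_tensor_in_sum_ball:
  assumes "\<And>i. i < l \<Longrightarrow> x i \<in> sum_ball {..<d i}"
  shows "elem_tensor l d x \<in> sum_ball (multi_indices l d)"
proof -
  have "norm (elem_tensor l d x) = (\<Prod>i<l. norm (x i))"
    using assms by (intro norm_elem_tensor) (auto simp: sum_ball_def eucl_def)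
  also have "\<dots> \<le> 1"
    using assms by (intro prod_le_1) (auto simp: sum_ball_def)
  finally show ?thesis
    using elem_tensor_in_tensor_space[of l d x] by (simp add: sum_ball_def tensor_space_def)
qed

lemma elem_tensor_in_max_ball:
  assumes "\<And>i. i < l \<Longrightarrow> x i \<in> max_ball {..<d i}"
  shows "elem_tensor l d x \<in> max_ball (multi_indices l d)"
proof -
  have "\<bar>lookup (elem_tensor l d x) j\<bar> \<le> 1" for j
    using assms by (auto simp: lookup_elem_tensor abs_prod max_ball_def intro!: prod_le_1)
  then show ?thesis
    using elem_tensor_in_tensor_space[of l d x] by (simp add: max_ball_def tensor_space_def)
qed

lemma proj_tensor_subset:
  assumes "\<And>x. (\<And>i. i < l \<Longrightarrow> x i \<in> Q i) \<Longrightarrow> elem_tensor l d x \<in> K" "convex K"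
  shows "proj_tensor l d Q \<subseteq> K"
  unfolding proj_tensor_def using assms by (intro hull_minimal) auto

lemma proj_tensor_sum_ball:
  assumes "\<And>i. i < l \<Longrightarrow> Q i \<subseteq> sum_ball {..<d i}"
  shows "proj_tensor l d Q \<subseteq> sum_ball (multi_indices l d)"
  by (rule proj_tensor_subset) (use assms in \<open>auto intro: elem_tensor_in_sum_ball convex_sum_ball\<close>)

lemma proj_tensor_max_ball:
  assumes "\<And>i. i < l \<Longrightarrow> Q i \<subseteq> max_ball {..<d i}"
  shows "proj_tensor l d Q \<subseteq> max_ball (multi_indices l d)"
  by (rule proj_tensor_subset) (use assms in \<open>auto intro: elem_tensor_in_max_ball convex_max_ball\<close>)

lemma subset_inj_tensor:
  assumes "K \<subseteq> tensor_space l d"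
    and "\<And>x y. x \<in> K \<Longrightarrow> y \<in> proj_tensor l d (\<lambda>i. polar (eucl (d i)) (Q i)) \<Longrightarrow> dot x y \<le> 1"
  shows "K \<subseteq> inj_tensor l d Q"
  using assms by (auto simp: inj_tensor_def polar_def[of "tensor_space l d"] dot_commute)

lemma tensorial_bodiesI:
  assumes "K \<in> sym_convex_bodies (tensor_space l d)"
    and "\<And>i. i < l \<Longrightarrow> Q i \<in> sym_convex_bodies (eucl (d i))"
    and "proj_tensor l d Q \<subseteq> K"
    and "\<And>x y. x \<in> K \<Longrightarrow> y \<in> proj_tensor l d (\<lambda>i. polar (eucl (d i)) (Q i)) \<Longrightarrow> dot x y \<le> 1"
  shows "K \<in> tensorial_bodies l d"
proof -
  have "K \<subseteq> inj_tensor l d Q"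
    using sym_convex_bodiesD(1)[OF assms(1)] assms(4) by (rule subset_inj_tensor)
  then show ?thesis
    using assms(1-3) unfolding tensorial_bodies_def by blast
qed

text \<open>The factors are cross-polytopes. Their polars lie in cubes, so the projective product of
  the polars lies in the big cube, which pairs with the big cross-polytope to at most 1.\<close>

lemma sum_ball_tensorial: "sum_ball (multi_indices l d) \<in> tensorial_bodies l d"
proof (rule tensorial_bodiesI)
  show "sum_ball (multi_indices l d) \<in> sym_convex_bodies (tensor_space l d)"
    unfolding tensor_space_def by (rule sum_ball_in_bodies[OF finite_multi_indices])
  show "sum_ball {..<d i} \<in> sym_convex_bodies (eucl (d i))" for i
    unfolding eucl_def by (rule sum_ball_in_bodies) simp
  show "proj_tensor l d (\<lambda>i. sum_ball {..<d i}) \<subseteq> sum_ball (multi_indices l d)"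
    by (rule proj_tensor_sum_ball) simp
  have polar: "proj_tensor l d (\<lambda>i. polar (eucl (d i)) (sum_ball {..<d i})) \<subseteq> max_ball (multi_indices l d)"
    by (rule proj_tensor_max_ball) (simp add: eucl_def polar_sum_ball)
  show "dot x y \<le> 1"
    if "x \<in> sum_ball (multi_indices l d)"
      "y \<in> proj_tensor l d (\<lambda>i. polar (eucl (d i)) (sum_ball {..<d i}))" for x y
    using that(1) subsetD[OF polar that(2)] by (rule dot_sum_ball_max_ball)
qed

text \<open>The dual argument, with cubes as factors and cross-polytopes containing their
  polars.\<close>

lemma max_ball_tensorial: "max_ball (multi_indices l d) \<in> tensorial_bodies l d"
proof (rule tensorial_bodiesI)
  show "max_ball (multi_indices l d) \<in> sym_convex_bodies (tensor_space l d)"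
    unfolding tensor_space_def by (rule max_ball_in_bodies[OF finite_multi_indices])
  show "max_ball {..<d i} \<in> sym_convex_bodies (eucl (d i))" for i
    unfolding eucl_def by (rule max_ball_in_bodies) simp
  show "proj_tensor l d (\<lambda>i. max_ball {..<d i}) \<subseteq> max_ball (multi_indices l d)"
    by (rule proj_tensor_max_ball) simp
  have polar: "proj_tensor l d (\<lambda>i. polar (eucl (d i)) (max_ball {..<d i})) \<subseteq> sum_ball (multi_indices l d)"
    by (rule proj_tensor_sum_ball) (simp add: eucl_def polar_max_ball)
  show "dot x y \<le> 1"
    if "x \<in> max_ball (multi_indices l d)"
      "y \<in> proj_tensor l d (\<lambda>i. polar (eucl (d i)) (max_ball {..<d i}))" for x y
    unfolding dot_commute[of x] using subsetD[OF polar that(2)] that(1) by (rule dot_sum_ball_max_ball)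
qed

section \<open>Support functions of tensorial bodies\<close>

text \<open>Compactness gives a maximiser of the functional \<open>y\<close>. The maximum is
  positive because an interior point can be moved a little in direction \<open>y\<close> without
  leaving \<open>P\<close>.\<close>

lemma sym_convex_bodies_support:
  assumes P: "P \<in> sym_convex_bodies (coord_space I)" and y: "y \<in> coord_space I" "y \<noteq> 0"
  obtains x where "x \<in> P" "dot x y > 0" "\<And>z. z \<in> P \<Longrightarrow> dot z y \<le> dot x y"
proof -
  obtain U x0 where U: "openin (top_of_set (coord_space I)) U" "x0 \<in> U" "U \<subseteq> P"
    using sym_convex_bodiesD(3)[OF P] by (auto simp: interior_of_def)
  then obtain W where W: "open W" "U = coord_space I \<inter> W"
    by (auto simp: openin_open)
  have x0: "x0 \<in> coord_space I" "x0 \<in> W" "x0 \<in> P"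
    using U W by auto
  have "((\<lambda>e. x0 + e *\<^sub>R y) \<longlongrightarrow> x0 + 0 *\<^sub>R y) (at_right 0)"
    by (intro tendsto_intros)
  then have "eventually (\<lambda>e. x0 + e *\<^sub>R y \<in> W) (at_right 0)"
    using W(1) x0(2) by (simp add: tendsto_def)
  then have "eventually (\<lambda>e. x0 + e *\<^sub>R y \<in> W \<and> e > 0) (at_right 0)"
    using eventually_at_right_less[of "0::real"] by eventually_elim auto
  then obtain e where e: "x0 + e *\<^sub>R y \<in> W" "e > 0"
    using eventually_happens'[OF trivial_limit_at_right_real] by blast
  then have e_mem: "x0 + e *\<^sub>R y \<in> P"
    using U W x0 y by (auto simp: coord_space_add coord_space_scaleR)
  have "- x0 \<in> P"
    using P x0(3) by (rule sym_convex_bodiesD)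
  have "dot (x0 + e *\<^sub>R y) y > dot x0 y"
    using e(2) dot_self_pos[OF y(2)] by (simp add: dot_add_left dot_scaleR_left)
  \<comment> \<open>If \<open>dot x0 y\<close> is negative, \<open>- x0\<close> is such a point;
    otherwise the shifted point is.\<close>
  then have pos: "\<exists>z\<in>P. dot z y > 0"
    using e_mem \<open>- x0 \<in> P\<close> dot_minus_left[of x0 y]
    by (metis le_less_trans neg_0_less_iff_less not_le)
  have "compact P" "P \<noteq> {}"
    using sym_convex_bodiesD(2)[OF P] x0(3) by auto
  moreover have "continuous_on P (\<lambda>x. dot x y)"
    by (intro bounded_linear.continuous_on[OF bounded_linear_dot_left] continuous_on_id)
  ultimately obtain x where "x \<in> P" "\<forall>z\<in>P. dot z y \<le> dot x y"
    using continuous_attains_sup[of P "\<lambda>x. dot x y"] by blast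
  with pos that show ?thesis by (meson less_le_trans)
qed

lemma elem_tensor_scaleR:
  "elem_tensor l d (\<lambda>i. c i *\<^sub>R x i) = (\<Prod>i<l. c i) *\<^sub>R elem_tensor l d x"
  by (rule poly_mapping_eqI) (simp add: lookup_elem_tensor prod.distrib)

text \<open>The two inclusions of the sandwich give the two halves: the injective product bounds the
  support function from above, and the projective product contains a point attaining the bound. The
  function \<open>h i\<close> is the support function of \<open>Q i\<close> at nonzero
  vectors.\<close>

lemma tensorial_bodies_support_multiplicative:
  assumes "K \<in> tensorial_bodies l d"
  obtains h :: "nat \<Rightarrow> (nat \<Rightarrow>\<^sub>0 real) \<Rightarrow> real"
  where "\<And>y z. (\<And>i. i < l \<Longrightarrow> y i \<in> eucl (d i) - {0}) \<Longrightarrow> z \<in> K \<Longrightarrow>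
          dot z (elem_tensor l d y) \<le> (\<Prod>i<l. h i (y i))"
    and "\<And>y. (\<And>i. i < l \<Longrightarrow> y i \<in> eucl (d i) - {0}) \<Longrightarrow>
          \<exists>z\<in>K. dot z (elem_tensor l d y) = (\<Prod>i<l. h i (y i))"
proof -
  obtain Q where Q: "\<And>i. i < l \<Longrightarrow> Q i \<in> sym_convex_bodies (eucl (d i))"
    and proj: "proj_tensor l d Q \<subseteq> K" and inj: "K \<subseteq> inj_tensor l d Q"
    using assms by (auto simp: tensorial_bodies_def)
  \<comment> \<open>The guard stands under the quantifier so that a total choice function
    \<open>m\<close> of maximisers can be extracted.\<close>
  have "\<exists>x. i < l \<and> y \<in> eucl (d i) - {0} \<longrightarrow>
      x \<in> Q i \<and> dot x y > 0 \<and> (\<forall>z\<in>Q i. dot z y \<le> dot x y)" for i y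
    using Q sym_convex_bodies_support unfolding eucl_def by (metis DiffD1 DiffD2 singletonI)
  then obtain m where m: "\<And>i y. i < l \<Longrightarrow> y \<in> eucl (d i) - {0} \<Longrightarrow>
      m i y \<in> Q i \<and> dot (m i y) y > 0 \<and> (\<forall>z\<in>Q i. dot z y \<le> dot (m i y) y)"
    by metis
  define h where "h i y = dot (m i y) y" for i y
  show ?thesis
  proof
    fix y z assume y: "\<And>i. i < l \<Longrightarrow> y i \<in> eucl (d i) - {0}" and z: "z \<in> K"
    \<comment> \<open>Dividing by the positive support value places \<open>y i\<close> in the polar
      of \<open>Q i\<close>, so the tensor of the scaled vectors pairs with \<open>z\<close> to at
      most 1.\<close>
    let ?w = "\<lambda>i. (1 / h i (y i)) *\<^sub>R y i"
    have pos: "h i (y i) > 0" if "i < l" for i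
      using m[OF that y[OF that]] by (simp add: h_def)
    have "?w i \<in> polar (eucl (d i)) (Q i)" if "i < l" for i
      using m[OF that y[OF that]] y[OF that]
      by (auto simp: polar_def eucl_def coord_space_scaleR dot_scaleR_right h_def divide_le_eq_1)
    then have "elem_tensor l d ?w \<in> proj_tensor l d (\<lambda>i. polar (eucl (d i)) (Q i))"
      unfolding proj_tensor_def by (intro hull_inc) blast
    then have "dot (elem_tensor l d ?w) z \<le> 1"
      using z inj by (auto simp: inj_tensor_def polar_def[of "tensor_space l d"])
    then have "dot z (elem_tensor l d y) / (\<Prod>i<l. h i (y i)) \<le> 1"
      by (simp only: elem_tensor_scaleR dot_scaleR_left dot_commute[of z]) (simp add: prod_dividef)
    moreover have "(\<Prod>i<l. h i (y i)) > 0"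
      using pos by (intro prod_pos) auto
    ultimately show "dot z (elem_tensor l d y) \<le> (\<Prod>i<l. h i (y i))"
      by (simp only: pos_divide_le_eq mult_1_left)
  next
    fix y assume y: "\<And>i. i < l \<Longrightarrow> y i \<in> eucl (d i) - {0}"
    \<comment> \<open>The tensor of the factorwise maximisers lies in the projective product and
      attains the bound.\<close>
    let ?x = "\<lambda>i. m i (y i)"
    have x: "?x i \<in> Q i" if "i < l" for i
      using m[OF that y[OF that]] by blast
    then have "elem_tensor l d ?x \<in> proj_tensor l d Q"
      unfolding proj_tensor_def by (intro hull_inc) blast
    moreover have "dot (elem_tensor l d ?x) (elem_tensor l d y) = (\<Prod>i<l. h i (y i))"
      using x sym_convex_bodiesD(1)[OF Q] unfolding h_def by (intro dot_elem_tensor) auto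
    ultimately show "\<exists>z\<in>K. dot z (elem_tensor l d y) = (\<Prod>i<l. h i (y i))"
      using proj by blast
  qed
qed

text \<open>The tensor of the \<open>y i\<close> has entries 0 and 1, with maximum norm 1 and sum
  norm \<open>2 ^ card A\<close>. These are its support values for the cross-polytope and the cube,
  and support values add under Minkowski sums.\<close>

lemma support_sum_ball_plus_max_ball:
  assumes "\<And>i. i < l \<Longrightarrow> d i \<ge> 2" and "A \<subseteq> {..<l}"
  defines "y \<equiv> \<lambda>i. single 0 1 + (if i \<in> A then single 1 1 else 0)"
  shows "\<And>x z. x \<in> sum_ball (multi_indices l d) \<Longrightarrow> z \<in> max_ball (multi_indices l d) \<Longrightarrow>
      dot (x + z) (elem_tensor l d y) \<le> 1 + 2 ^ card A"
    and "\<exists>x\<in>sum_ball (multi_indices l d). \<exists>z\<in>max_ball (multi_indices l d).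
      dot (x + z) (elem_tensor l d y) = 1 + 2 ^ card A"
proof -
  have lookup_y: "lookup (y i) k = (if k = 0 \<or> k = 1 \<and> i \<in> A then 1 else 0)" for i k
    by (auto simp: y_def lookup_add lookup_single when_def)
  have y_max: "y i \<in> max_ball {..<d i}" if "i < l" for i
    using assms(1)[OF that] by (auto simp: max_ball_def coord_space_def in_keys_iff lookup_y split: if_splits)
  then have y_eucl: "y i \<in> eucl (d i)" if "i < l" for i
    using that by (auto simp: max_ball_def eucl_def)
  have card: "(\<Prod>i<l. if i \<in> A then 2 else 1 :: real) = 2 ^ card A"
    using assms(2) by (simp add: prod.If_cases Int_absorb1 flip: prod.inter_restrict)
  have e_sum: "single 0 1 \<in> sum_ball {..<d i}" if "i < l" for i
    using assms(1)[OF that] by (auto simp: sum_ball_def norm_single coord_space_def)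
  have keys_y: "keys (y i) = (if i \<in> A then {0, 1} else {0})" for i
    by (auto simp: in_keys_iff lookup_y split: if_splits)
  have "norm (y i) = (if i \<in> A then 2 else 1)" for i
    by (simp add: norm_eq_sum_keys keys_y lookup_y)
  then have norm_y: "norm (elem_tensor l d y) = 2 ^ card A"
    by (simp add: norm_elem_tensor[OF y_eucl] card)
  have y_tensor: "elem_tensor l d y \<in> max_ball (multi_indices l d)"
    using y_max by (rule elem_tensor_in_max_ball)
  show "dot (x + z) (elem_tensor l d y) \<le> 1 + 2 ^ card A"
    if "x \<in> sum_ball (multi_indices l d)" "z \<in> max_ball (multi_indices l d)" for x z
  proof -
    have "dot x (elem_tensor l d y) \<le> 1"
      using that(1) y_tensor by (rule dot_sum_ball_max_ball)
    moreover have "dot z (elem_tensor l d y) \<le> 2 ^ card A"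
      using dot_le_norm[of z 1 "elem_tensor l d y"] that(2) norm_y
      by (simp add: max_ball_def dot_commute[of z])
    ultimately show ?thesis
      by (simp add: dot_add_left)
  qed
  have dot_y: "dot (y i) (y i) = (if i \<in> A then 2 else 1)" for i
    by (simp add: dot_def keys_y lookup_y)
  \<comment> \<open>Maximiser in the cross-polytope: the basis vector at an entry where the tensor
    of the \<open>y i\<close> equals 1. In the cube that tensor is its own maximiser, being a 0-1
    vector.\<close>
  let ?e = "elem_tensor l d (\<lambda>i. single 0 1)"
  have e_tensor: "?e \<in> sum_ball (multi_indices l d)"
    using e_sum by (rule elem_tensor_in_sum_ball)
  have "dot ?e (elem_tensor l d y) = 1"
    using e_sum by (subst dot_elem_tensor) (auto simp: sum_ball_def eucl_def dot_single_left lookup_y)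
  moreover have "dot (elem_tensor l d y) (elem_tensor l d y) = 2 ^ card A"
    by (simp add: dot_elem_tensor[OF y_eucl] dot_y card)
  ultimately have "dot (?e + elem_tensor l d y) (elem_tensor l d y) = 1 + 2 ^ card A"
    by (simp add: dot_add_left)
  with e_tensor y_tensor show "\<exists>x\<in>sum_ball (multi_indices l d). \<exists>z\<in>max_ball (multi_indices l d).
      dot (x + z) (elem_tensor l d y) = 1 + 2 ^ card A"
    by blast
qed

theorem proposition4p1:
  fixes l :: nat and d :: "nat \<Rightarrow> nat"
  assumes "l \<ge> 2" and "\<And>i. i < l \<Longrightarrow> d i \<ge> 2"
  shows "\<exists>P \<in> tensorial_bodies l d. \<exists>R \<in> tensorial_bodies l d.
    {x + y | x y. x \<in> P \<and> y \<in> R} \<notin> tensorial_bodies l d"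
proof -
  let ?P = "sum_ball (multi_indices l d)" and ?R = "max_ball (multi_indices l d)"
  let ?K = "{x + y | x y. x \<in> ?P \<and> y \<in> ?R}"
  have "?K \<notin> tensorial_bodies l d"
  proof
    assume "?K \<in> tensorial_bodies l d"
    then obtain h where
        upper: "\<And>y z. (\<And>i. i < l \<Longrightarrow> y i \<in> eucl (d i) - {0}) \<Longrightarrow> z \<in> ?K \<Longrightarrow>
          dot z (elem_tensor l d y) \<le> (\<Prod>i<l. h i (y i))"
      and attained: "\<And>y. (\<And>i. i < l \<Longrightarrow> y i \<in> eucl (d i) - {0}) \<Longrightarrow>
          \<exists>z\<in>?K. dot z (elem_tensor l d y) = (\<Prod>i<l. h i (y i))"
      by (rule tensorial_bodies_support_multiplicative) blast
    define y :: "nat set \<Rightarrow> nat \<Rightarrow> nat \<Rightarrow>\<^sub>0 real" where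
      "y A = (\<lambda>i. single 0 1 + (if i \<in> A then single 1 1 else 0))" for A
    have lookup_y: "lookup (y A i) k = (if k = 0 \<or> k = 1 \<and> i \<in> A then 1 else 0)" for A i k
      by (auto simp: y_def lookup_add lookup_single when_def)
    have y: "y A i \<in> eucl (d i) - {0}" if "i < l" for A i
    proof -
      have "lookup (y A i) 0 \<noteq> 0"
        by (simp add: lookup_y)
      then have "y A i \<noteq> 0"
        by auto
      then show ?thesis
        using assms(2)[OF that]
        by (auto simp: eucl_def coord_space_def in_keys_iff lookup_y split: if_splits)
    qed
    have support: "(\<Prod>i<l. h i (y A i)) = 1 + 2 ^ card A" if "A \<subseteq> {..<l}" for A
    proof (rule antisym)
      obtain x z where "x \<in> ?P" "z \<in> ?R" "dot (x + z) (elem_tensor l d (y A)) = (\<Prod>i<l. h i (y A i))"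
        using attained[of "y A"] y by blast
      then show "(\<Prod>i<l. h i (y A i)) \<le> 1 + 2 ^ card A"
        using support_sum_ball_plus_max_ball(1)[of l d A x z, OF assms(2) that]
        unfolding y_def[abs_def] by metis
      have "\<exists>x\<in>?P. \<exists>z\<in>?R. dot (x + z) (elem_tensor l d (y A)) = 1 + 2 ^ card A"
        using support_sum_ball_plus_max_ball(2)[of l d A, OF assms(2) that] unfolding y_def .
      then show "1 + 2 ^ card A \<le> (\<Prod>i<l. h i (y A i))"
        using upper[of "y A", OF y] by fastforce
    qed
    \<comment> \<open>Slot \<open>i\<close> depends only on whether \<open>i\<close> is in the set.
      For \<open>i = 0\<close> and \<open>i = 1\<close> the two sides contain the same factors,
      possibly swapped; in all other slots the four vectors coincide.\<close>
    have "h i (y {} i) * h i (y {0, 1} i) = h i (y {0} i) * h i (y {1} i)" for i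
      by (cases "i = 0"; cases "i = 1") (auto simp: y_def)
    then have "(\<Prod>i<l. h i (y {} i)) * (\<Prod>i<l. h i (y {0, 1} i)) =
        (\<Prod>i<l. h i (y {0} i)) * (\<Prod>i<l. h i (y {1} i))"
      by (simp flip: prod.distrib)
    \<comment> \<open>As \<open>l \<ge> 2\<close>, all four sets lie in \<open>{..<l}\<close>, and
      \<open>support\<close> turns the identity into \<open>2 * 5 = 3 * 3\<close>.\<close>
    then show False
      using assms(1) by (simp add: support)
  qed
  then show ?thesis
    using sum_ball_tensorial max_ball_tensorial by blast
qed

end
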